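(* Let $(A,B,p,r,c_R)$ be a linear production situation with a common-pool resource with producer set $N$, let $P=\{S_1,\ldots,S_k\}$ be a partition of $N$, and let $(X_1,\ldots,X_k;\pi_1,\ldots,\pi_k)$ be the associated non cooperative game among the coalitions of $P$. Then $(d_{S_1},\ldots,d_{S_k})$ is the only Nash equilibrium (in pure strategies) of $(X_1,\ldots,X_k;\pi_1,\ldots,\pi_k)$ if and only if $d(P)\le r$.
   Context: Linear production situation with a common-pool resource $(A,B,p,r,c_R)$: $N=\{1,\ldots,n\}$ is a finite set of producers, $Q=\{1,\ldots,q\}$ a finite set of resources, $G=\{1,\ldots,g\}$ a finite set of goods. Each producer $i\in N$ owns a resource vector $b^i\in\mathbb{R}_+^q$; $B$ is the $q\times n$ matrix of these vectors, and for each $t\in Q$ there is some $i\in N$ with $b^i_t>0$. For a (nonempty) coalition $S\subseteq N$, $b^S=\sum_{i\in S}b^i$. In addition there is a common-pool resource, with total available amount $r>0$ and fixed unit cost $c_R\ge 0$. $A$ is a $(q+1)\times g$ matrix with nonnegative entries $a_{tj}$ (amount of resource $t$ needed per unit of product $j$; row $q+1$ refers to the common-pool resource), with $a_{(q+1)j}>0$ for all $j\in G$, and for each $j\in G$ there is at least one $t\in Q$ with $a_{tj}>0$. The price vector $p\in\mathbb{R}^g$ has strictly positive entries and $p_j>a_{(q+1)j}c_R$ for all $j\in G$. For a coalition $S$ and $z\ge 0$, $value(S;z)$ is the maximum over $x\in\mathbb{R}^g$, $x\ge 0$, of $\sum_{j=1}^g p_jx_j-c_Rz$ subject to $Ax\le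 \begin{pmatrix} b^S\\ z\end{pmatrix}$. The optimal demand of $S$ is $d_S=\min\{z\in\mathbb{R}_+ : value(S;z)\text{ is maximum}\}$, i.e. the least maximizer of $z\mapsto value(S;z)$ over $\mathbb{R}_+$. Standing assumption: for every coalition $S$ there is $z\ge 0$ with $value(S;z)>0$ (hence $d_S>0$). For a partition $P=\{S_1,\ldots,S_k\}$ of $N$, $d(P)=\sum_{i=1}^k d_{S_i}$. The non cooperative game $(X_1,\ldots,X_k;\pi_1,\ldots,\pi_k)$ among the coalitions of $P$: player $i$ is coalition $S_i$, its strategy set is $X_i=[0,d_{S_i}]$, and its payoff is $\pi_i(z_1,\ldots,z_k)=0$ if $\sum_{l=1}^k z_l>r$ and $\pi_i(z_1,\ldots,z_k)=value(S_i;z_i)$ otherwise. A profile $z^*\in\prod_{i=1}^k X_i$ is a Nash equilibrium (in pure strategies) if for all $i$ and all $z_i\in X_i$, $\pi_i(z^* )\ge\pi_i(z_1^*,\ldots,z_{i-1}^*,z_i,z_{i+1}^*,\ldots,z_k^* )$. *)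

theory Defs
  imports "HOL-Analysis.Analysis" "HOL-Library.Disjoint_Sets"
begin

text \<open>
  Producers, resources and goods are indexed by finite types \<open>'n\<close>, \<open>'q\<close>, \<open>'g\<close>.
  The \<open>q + 1\<close> rows of the technology matrix are indexed by \<open>'q option\<close>:
  row \<open>Some t\<close> belongs to the owned resource \<open>t\<close>, row \<open>None\<close> to the common-pool resource.
  The \<open>i\<close>-th column of \<open>B\<close> is the resource vector of producer \<open>i\<close>.
\<close>

definition production_situation ::
  "real^'g^('q::finite option) \<Rightarrow> real^'n^'q \<Rightarrow> real^'g \<Rightarrow> real \<Rightarrow> real \<Rightarrow> bool" where
  "production_situation A B p r c \<longleftrightarrow>
     (\<forall>t i. 0 \<le> B $ t $ i) \<and> (\<forall>t. \<exists>i. 0 < B $ t $ i) \<and>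
     (\<forall>s j. 0 \<le> A $ s $ j) \<and> (\<forall>j. 0 < A $ None $ j) \<and> (\<forall>j. \<exists>t. 0 < A $ Some t $ j) \<and>
     (\<forall>j. 0 < p $ j) \<and> (\<forall>j. A $ None $ j * c < p $ j) \<and>
     0 < r \<and> 0 \<le> c"

definition coalition_resources :: "real^'n^'q \<Rightarrow> 'n set \<Rightarrow> real^'q" where
  "coalition_resources B S = (\<Sum>i\<in>S. column i B)"

definition available :: "real^'n^'q \<Rightarrow> 'n set \<Rightarrow> real \<Rightarrow> real^('q::finite option)" where
  "available B S z = (\<chi> s. case s of Some t \<Rightarrow> coalition_resources B S $ t | None \<Rightarrow> z)"

text \<open>The order on vectors is componentwise.\<close>

definition feasible_plans ::
  "real^'g^('q::finite option) \<Rightarrow> real^'n^'q \<Rightarrow> 'n set \<Rightarrow> real \<Rightarrow> (real^'g) set" where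
  "feasible_plans A B S z = {x. 0 \<le> x \<and> A *v x \<le> available B S z}"

text \<open>
  \<open>GREATEST\<close> and \<open>LEAST\<close> denote an attained maximum and minimum. Both exist for every
  production situation, nonempty \<open>S\<close> and \<open>z \<ge> 0\<close>; otherwise the value is unspecified.
\<close>

definition coalition_value ::
  "real^'g^('q::finite option) \<Rightarrow> real^'n^'q \<Rightarrow> real^'g \<Rightarrow> real \<Rightarrow> 'n set \<Rightarrow> real \<Rightarrow> real" where
  "coalition_value A B p c S z =
     (GREATEST v. \<exists>x\<in>feasible_plans A B S z. v = p \<bullet> x - c * z)"

definition optimal_demand ::
  "real^'g^('q::finite option) \<Rightarrow> real^'n^'q \<Rightarrow> real^'g \<Rightarrow> real \<Rightarrow> 'n set \<Rightarrow> real" where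
  "optimal_demand A B p c S =
     (LEAST z. 0 \<le> z \<and> (\<forall>w\<ge>0. coalition_value A B p c S w \<le> coalition_value A B p c S z))"

definition partition_demand ::
  "real^'g^('q::finite option) \<Rightarrow> real^'n^'q \<Rightarrow> real^'g \<Rightarrow> real \<Rightarrow> 'n set set \<Rightarrow> real" where
  "partition_demand A B p c P = (\<Sum>S\<in>P. optimal_demand A B p c S)"

text \<open>
  Profiles are extensional functions on the player set \<open>I\<close>, so that equality of profiles
  is equality at all players.
\<close>

definition nash_equilibrium ::
  "'i set \<Rightarrow> ('i \<Rightarrow> 'a set) \<Rightarrow> ('i \<Rightarrow> ('i \<Rightarrow> 'a) \<Rightarrow> real) \<Rightarrow> ('i \<Rightarrow> 'a) \<Rightarrow> bool" where
  "nash_equilibrium I X u z \<longleftrightarrow>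
     z \<in> (\<Pi>\<^sub>E i\<in>I. X i) \<and> (\<forall>i\<in>I. \<forall>y\<in>X i. u i z \<ge> u i (z(i := y)))"

definition strategies ::
  "real^'g^('q::finite option) \<Rightarrow> real^'n^'q \<Rightarrow> real^'g \<Rightarrow> real \<Rightarrow>
   (nat \<Rightarrow> 'n set) \<Rightarrow> nat \<Rightarrow> real set" where
  "strategies A B p c S i = {0..optimal_demand A B p c (S i)}"

definition payoff ::
  "real^'g^('q::finite option) \<Rightarrow> real^'n^'q \<Rightarrow> real^'g \<Rightarrow> real \<Rightarrow> real \<Rightarrow>
   nat \<Rightarrow> (nat \<Rightarrow> 'n set) \<Rightarrow> nat \<Rightarrow> (nat \<Rightarrow> real) \<Rightarrow> real" where
  "payoff A B p r c k S i z =
     (if (\<Sum>l\<in>{1..k}. z l) > r then 0 else coalition_value A B p c (S i) (z i))"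

end

theory Submission
  imports Defs
begin

text \<open>
  The value of a coalition is a concave function of the amount of common-pool resource, so it
  increases strictly up to its least maximizer. If the demands fit into \<open>r\<close>, they are therefore
  strictly dominant strategies. If they do not, every profile that uses up exactly \<open>r\<close> is an
  equilibrium, and scaling the demands by \<open>r / d(P)\<close> gives such a profile other than
  the demands themselves.
\<close>

section \<open>Production plans and their compactness\<close>

lemma production_situationD:
  assumes "production_situation A B p r c"
  shows "0 \<le> B $ t $ i" and "0 \<le> A $ s $ j" and "0 < A $ None $ j"
    and "\<exists>t. 0 < A $ Some t $ j" and "0 < r" and "0 \<le> c"
  using assms unfolding production_situation_def by auto

text \<open>Separates the constraints that do not involve the common pool. The resulting set does
  not depend on \<open>z\<close>, so optimal plans for different amounts can be compared inside one
  compact set.\<close>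

definition own_plans ::
  "real^'g^('q::finite option) \<Rightarrow> real^'n^'q \<Rightarrow> 'n set \<Rightarrow> (real^'g) set" where
  "own_plans A B S = {x. 0 \<le> x \<and> (\<forall>t. (A *v x) $ Some t \<le> coalition_resources B S $ t)}"

lemma feasible_plans_eq:
  "feasible_plans A B S z = {x \<in> own_plans A B S. (A *v x) $ None \<le> z}"
proof -
  have "A *v x \<le> available B S z \<longleftrightarrow>
      (\<forall>t. (A *v x) $ Some t \<le> coalition_resources B S $ t) \<and> (A *v x) $ None \<le> z" for x
    unfolding less_eq_vec_def available_def by (auto split: option.split)
  then show ?thesis
    unfolding feasible_plans_def own_plans_def by auto
qed

lemma continuous_on_matrix_vector_component:
  fixes A :: "real^'g^'m::finite"
  shows "continuous_on X (\<lambda>x. (A *v x) $ s)"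
  by (intro continuous_intros linear_continuous_on matrix_vector_mul_bounded_linear)

lemma closed_own_plans: "closed (own_plans A B S)"
proof -
  have "own_plans A B S =
      (\<Inter>j. {x. 0 \<le> x $ j}) \<inter> (\<Inter>t. {x. (A *v x) $ Some t \<le> coalition_resources B S $ t})"
    unfolding own_plans_def less_eq_vec_def by auto
  also have "closed \<dots>"
    by (intro closed_Int closed_INT ballI closed_Collect_le continuous_on_matrix_vector_component
        continuous_intros)
  finally show ?thesis .
qed

lemma mult_component_le_matrix_vector:
  fixes A :: "real^'g^'m::finite"
  assumes "\<And>j. 0 \<le> A $ s $ j" and "0 \<le> x"
  shows "A $ s $ j * x $ j \<le> (A *v x) $ s"
proof -
  have "A $ s $ j * x $ j \<le> (\<Sum>j\<in>UNIV. A $ s $ j * x $ j)"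
    using assms
    by (intro member_le_sum[of j UNIV "\<lambda>j. A $ s $ j * x $ j"]) (auto simp: less_eq_vec_def)
  then show ?thesis by (simp add: matrix_vector_mult_def)
qed

text \<open>Every good consumes a positive amount of some owned resource \<open>t j\<close>. The
  stock of that resource bounds the output of the good, which places all plans in a box.\<close>

lemma compact_own_plans:
  assumes "production_situation A B p r c"
  shows "compact (own_plans A B S)"
proof -
  obtain t where t: "0 < A $ Some (t j) $ j" for j
    using production_situationD(4)[OF assms] by metis
  have "own_plans A B S \<subseteq> cbox 0 (\<chi> j. coalition_resources B S $ t j / A $ Some (t j) $ j)"
  proof
    fix x assume x: "x \<in> own_plans A B S"
    then have nonneg: "0 \<le> x" by (simp add: own_plans_def)
    have "x $ j \<le> coalition_resources B S $ t j / A $ Some (t j) $ j" for j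
    proof -
      have "A $ Some (t j) $ j * x $ j \<le> (A *v x) $ Some (t j)"
        using production_situationD(2)[OF assms] nonneg
        by (rule mult_component_le_matrix_vector)
      also have "\<dots> \<le> coalition_resources B S $ t j"
        using x by (simp add: own_plans_def)
      finally show ?thesis using t[of j] by (simp add: field_simps)
    qed
    with nonneg show "x \<in> cbox 0 (\<chi> j. coalition_resources B S $ t j / A $ Some (t j) $ j)"
      by (simp add: mem_box_cart less_eq_vec_def)
  qed
  then show ?thesis
    using closed_own_plans bounded_cbox bounded_subset compact_eq_bounded_closed by blast
qed

lemma zero_in_own_plans:
  assumes "production_situation A B p r c"
  shows "0 \<in> own_plans A B S"
  using production_situationD(1)[OF assms]
  by (auto simp: own_plans_def coalition_resources_def column_def intro!: sum_nonneg)

section \<open>The value as a function of the common-pool amount\<close>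

lemma coalition_value_attained:
  assumes "production_situation A B p r c" and "0 \<le> z"
  shows "\<exists>x\<in>feasible_plans A B S z. coalition_value A B p c S z = p \<bullet> x - c * z"
    and "x \<in> feasible_plans A B S z \<Longrightarrow> p \<bullet> x - c * z \<le> coalition_value A B p c S z"
proof -
  have "compact (feasible_plans A B S z)"
  proof -
    have "feasible_plans A B S z = own_plans A B S \<inter> {x. (A *v x) $ None \<le> z}"
      by (auto simp: feasible_plans_eq)
    then show ?thesis
      using compact_own_plans[OF assms(1)] continuous_on_matrix_vector_component
      by (auto intro!: compact_Int_closed closed_Collect_le continuous_intros)
  qed
  moreover have "0 \<in> feasible_plans A B S z"
    using assms zero_in_own_plans by (simp add: feasible_plans_eq)
  ultimately obtain y where y: "y \<in> feasible_plans A B S z"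
      and max: "\<And>x. x \<in> feasible_plans A B S z \<Longrightarrow> p \<bullet> x \<le> p \<bullet> y"
    using continuous_attains_sup[of "feasible_plans A B S z" "\<lambda>x. p \<bullet> x"]
    by (force intro: continuous_intros)
  \<comment> \<open>The maximizing plan \<open>y\<close> makes the \<open>GREATEST\<close> in the
    definition well defined. The cost \<open>c * z\<close> is constant over plans, so maximizing
    revenue is enough.\<close>
  have "coalition_value A B p c S z = p \<bullet> y - c * z"
    unfolding coalition_value_def by (rule Greatest_equality) (use y max in auto)
  then show "\<exists>x\<in>feasible_plans A B S z. coalition_value A B p c S z = p \<bullet> x - c * z"
    and "x \<in> feasible_plans A B S z \<Longrightarrow> p \<bullet> x - c * z \<le> coalition_value A B p c S z"
    using y max by auto
qed

text \<open>Every good consumes some of the common pool, so without it nothing can be produced. This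
  makes the payoff 0 of an overdrawn pool comparable with the values of the coalitions.\<close>

lemma coalition_value_zero:
  assumes "production_situation A B p r c"
  shows "coalition_value A B p c S 0 = 0"
proof -
  obtain x where x: "x \<in> feasible_plans A B S 0" and v: "coalition_value A B p c S 0 = p \<bullet> x"
    using coalition_value_attained(1)[OF assms order_refl] by auto
  have "x $ j = 0" for j
  proof (rule antisym)
    have "A $ None $ j * x $ j \<le> (A *v x) $ None"
      using production_situationD(2)[OF assms] x
      by (intro mult_component_le_matrix_vector) (auto simp: feasible_plans_eq own_plans_def)
    then have "A $ None $ j * x $ j \<le> 0"
      using x by (simp add: feasible_plans_eq)
    then show "x $ j \<le> 0"
      using production_situationD(3)[OF assms, of j] by (simp add: mult_le_0_iff)
    show "0 \<le> x $ j"
      using x by (simp add: feasible_plans_eq own_plans_def less_eq_vec_def)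
  qed
  then have "x = 0" by (simp add: vec_eq_iff)
  with v show ?thesis by simp
qed

lemma feasible_plans_convex_combination:
  assumes "x \<in> feasible_plans A B S z" and "y \<in> feasible_plans A B S w"
    and "0 \<le> a" and "0 \<le> b" and "a + b = 1"
  shows "a *\<^sub>R x + b *\<^sub>R y \<in> feasible_plans A B S (a * z + b * w)"
proof -
  have comp: "(A *v (a *\<^sub>R x + b *\<^sub>R y)) $ s = a * (A *v x) $ s + b * (A *v y) $ s" for s
    by (simp add: matrix_vector_right_distrib matrix_vector_mult_scaleR)
  have "a * (A *v x) $ Some t + b * (A *v y) $ Some t \<le> coalition_resources B S $ t" for t
    using assms by (intro convex_bound_le) (auto simp: feasible_plans_eq own_plans_def)
  moreover have "a * (A *v x) $ None + b * (A *v y) $ None \<le> a * z + b * w"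
    using assms by (intro add_mono mult_left_mono) (auto simp: feasible_plans_eq)
  ultimately show ?thesis
    using assms
    by (simp add: feasible_plans_eq own_plans_def comp less_eq_vec_def)
qed

text \<open>The constraints are linear jointly in the plan and the amount. Mixing optimal plans for
  \<open>z\<close> and \<open>w\<close> therefore gives a plan feasible for the mixed amount, and it
  earns the mixed profit.\<close>

lemma concave_on_coalition_value:
  assumes "production_situation A B p r c"
  shows "concave_on {0..} (coalition_value A B p c S)"
  unfolding concave_on_iff
proof (intro conjI ballI allI impI)
  fix z w a b :: real
  assume "z \<in> {0..}" "w \<in> {0..}" and ab: "0 \<le> a" "0 \<le> b" "a + b = 1"
  then have zw: "0 \<le> z" "0 \<le> w" by auto
  obtain x y where x: "x \<in> feasible_plans A B S z" "coalition_value A B p c S z = p \<bullet> x - c * z"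
    and y: "y \<in> feasible_plans A B S w" "coalition_value A B p c S w = p \<bullet> y - c * w"
    using coalition_value_attained(1)[OF assms] zw by meson
  have "p \<bullet> (a *\<^sub>R x + b *\<^sub>R y) - c * (a * z + b * w) \<le> coalition_value A B p c S (a * z + b * w)"
    using zw ab x(1) y(1)
    by (intro coalition_value_attained(2)[OF assms] feasible_plans_convex_combination) auto
  then show "a * coalition_value A B p c S z + b * coalition_value A B p c S w
      \<le> coalition_value A B p c S (a *\<^sub>R z + b *\<^sub>R w)"
    by (simp add: x(2) y(2) algebra_simps)
qed simp

section \<open>Optimal demand and strict growth of the value below it\<close>

text \<open>Maximizing over amounts is replaced by maximizing over plans, which form a compact set
  although the amounts range over an unbounded interval. Among the most profitable plans, one with
  the least use of the common pool determines the demand.\<close>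

lemma least_maximizer_coalition_value:
  assumes "production_situation A B p r c"
  shows "\<exists>d\<ge>0. (\<forall>w\<ge>0. coalition_value A B p c S w \<le> coalition_value A B p c S d) \<and>
    (\<forall>z\<ge>0. coalition_value A B p c S d \<le> coalition_value A B p c S z \<longrightarrow> d \<le> z)"
proof -
  let ?V = "coalition_value A B p c S" and ?K = "own_plans A B S"
  \<comment> \<open>Profit when the coalition buys exactly the amount of common-pool resource that it uses.\<close>
  define f where "f x = p \<bullet> x - c * (A *v x) $ None" for x
  have cont: "continuous_on X f" for X
    unfolding f_def by (intro continuous_intros continuous_on_matrix_vector_component)
  have c: "0 \<le> c" using production_situationD(6)[OF assms] .
  obtain x0 where x0: "x0 \<in> ?K" and x0_max: "\<And>x. x \<in> ?K \<Longrightarrow> f x \<le> f x0"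
    using continuous_attains_sup[OF compact_own_plans[OF assms] _ cont] zero_in_own_plans[OF assms]
    by blast
  \<comment> \<open>These are exactly the maximizers of \<open>f\<close> on \<open>?K\<close>; the
    inequality form shows directly that the set is closed.\<close>
  let ?M = "?K \<inter> {x. f x0 \<le> f x}"
  have "compact ?M"
    using compact_own_plans[OF assms] cont
    by (intro compact_Int_closed closed_Collect_le continuous_intros) auto
  then obtain y where y: "y \<in> ?M" and y_min: "\<And>x. x \<in> ?M \<Longrightarrow> (A *v y) $ None \<le> (A *v x) $ None"
    using continuous_attains_inf[OF _ _ continuous_on_matrix_vector_component, of ?M] x0 by blast
  let ?d = "(A *v y) $ None"
  have d_nonneg: "0 \<le> ?d"
    using y production_situationD(2)[OF assms]
    by (auto simp: own_plans_def less_eq_vec_def matrix_vector_mult_def intro!: sum_nonneg)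
  \<comment> \<open>Since \<open>c\<close> is nonnegative, charging only for the amount used instead
    of all of \<open>z\<close> cannot lower the profit.\<close>
  have value_le: "\<exists>x\<in>?K. (A *v x) $ None \<le> z \<and> ?V z \<le> f x" if "0 \<le> z" for z
  proof -
    obtain x where x: "x \<in> feasible_plans A B S z" "?V z = p \<bullet> x - c * z"
      using coalition_value_attained(1)[OF assms \<open>0 \<le> z\<close>] by blast
    then show ?thesis
      using mult_left_mono[OF _ c] by (force simp: feasible_plans_eq f_def)
  qed
  have d_ge: "f x0 \<le> ?V ?d"
  proof -
    have "f x0 \<le> f y" using y by simp
    also have "\<dots> \<le> ?V ?d"
      unfolding f_def using y
      by (intro coalition_value_attained(2)[OF assms d_nonneg]) (simp add: feasible_plans_eq)
    finally show ?thesis .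
  qed
  show ?thesis
  proof (intro exI[of _ ?d] conjI allI impI d_nonneg)
    fix w :: real assume "0 \<le> w"
    then show "?V w \<le> ?V ?d"
      using value_le x0_max d_ge by (meson order_trans)
  next
    fix z :: real assume "0 \<le> z" "?V ?d \<le> ?V z"
    \<comment> \<open>A value as high as that at \<open>?d\<close> comes from a plan in
      \<open>?M\<close> that fits into \<open>z\<close>, and \<open>y\<close> uses the least among
      such plans.\<close>
    then obtain x where x: "x \<in> ?K" "(A *v x) $ None \<le> z" "f x0 \<le> f x"
      using value_le d_ge by (meson order_trans)
    then show "?d \<le> z"
      using y_min[of x] by auto
  qed
qed

text \<open>The inequality below the demand is strict because an amount with equal value would be a
  smaller maximizer.\<close>

lemma optimal_demand_is_least_maximizer:
  assumes "production_situation A B p r c"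
  shows "0 \<le> optimal_demand A B p c S"
    and "0 \<le> w \<Longrightarrow> coalition_value A B p c S w
      \<le> coalition_value A B p c S (optimal_demand A B p c S)"
    and "0 \<le> z \<Longrightarrow> z < optimal_demand A B p c S \<Longrightarrow>
      coalition_value A B p c S z < coalition_value A B p c S (optimal_demand A B p c S)"
proof -
  let ?V = "coalition_value A B p c S"
  obtain d where d: "0 \<le> d" "\<And>w. 0 \<le> w \<Longrightarrow> ?V w \<le> ?V d"
      and least: "\<And>z. 0 \<le> z \<Longrightarrow> ?V d \<le> ?V z \<Longrightarrow> d \<le> z"
    using least_maximizer_coalition_value[OF assms] by meson
  have "optimal_demand A B p c S = d"
    unfolding optimal_demand_def by (rule Least_equality) (use d least in auto)
  then show "0 \<le> optimal_demand A B p c S"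
    and "0 \<le> w \<Longrightarrow> ?V w \<le> ?V (optimal_demand A B p c S)"
    and "0 \<le> z \<Longrightarrow> z < optimal_demand A B p c S \<Longrightarrow> ?V z < ?V (optimal_demand A B p c S)"
    using d least by (auto simp: not_le[symmetric])
qed

text \<open>For \<open>z < w\<close>, the point \<open>w\<close> is a mixture of \<open>z\<close>
  and \<open>d\<close> with positive weight on \<open>d\<close>. Since \<open>f d\<close> exceeds
  \<open>f z\<close>, so does the mixture of the two, and concavity puts \<open>f w\<close> at or
  above that mixture.\<close>

lemma strict_mono_on_concave:
  fixes f :: "real \<Rightarrow> real"
  assumes "concave_on {a..d} f" and "\<And>z. a \<le> z \<Longrightarrow> z < d \<Longrightarrow> f z < f d"
  shows "strict_mono_on {a..d} f"
proof (rule strict_mono_onI)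
  fix z w assume zw: "z \<in> {a..d}" "w \<in> {a..d}" "z < w"
  define u where "u = (w - z) / (d - z)"
  have u: "0 < u" "u \<le> 1" using zw by (auto simp: u_def field_simps)
  have w: "w = (1 - u) * z + u * d"
  proof -
    have "u * (d - z) = w - z" using zw by (simp add: u_def)
    then show ?thesis by (simp add: algebra_simps)
  qed
  have "f z < f d" using zw by (intro assms(2)) auto
  then have "f z < (1 - u) * f z + u * f d"
    using u by (simp add: algebra_simps)
  also have "\<dots> \<le> f ((1 - u) * z + u * d)"
    using concave_onD[OF assms(1), of u z d] u zw by auto
  finally show "f z < f w" unfolding w[symmetric] .
qed

lemma strict_mono_on_coalition_value:
  assumes "production_situation A B p r c"
  shows "strict_mono_on {0..optimal_demand A B p c S} (coalition_value A B p c S)"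
proof (rule strict_mono_on_concave)
  show "concave_on {0..optimal_demand A B p c S} (coalition_value A B p c S)"
    using concave_on_coalition_value[OF assms] unfolding concave_on_def
    by (rule convex_on_subset) auto
qed (rule optimal_demand_is_least_maximizer(3)[OF assms])

section \<open>Nash equilibria when the demands fit into the pool, and when the pool is exactly
  exhausted\<close>

lemma nash_equilibrium_iff_if_demand_le:
  assumes ps: "production_situation A B p r c"
    and le: "(\<Sum>i\<in>{1..k}. optimal_demand A B p c (S i)) \<le> r"
  shows "nash_equilibrium {1..k} (strategies A B p c S) (payoff A B p r c k S) z \<longleftrightarrow>
    z = (\<lambda>i\<in>{1..k}. optimal_demand A B p c (S i))"
proof -
  let ?X = "strategies A B p c S" and ?u = "payoff A B p r c k S"
  let ?d = "\<lambda>i. optimal_demand A B p c (S i)" and ?V = "\<lambda>i. coalition_value A B p c (S i)"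
  \<comment> \<open>No profile of strategies can overdraw the pool, so the game decouples: each
    payoff depends only on the coalition's own amount.\<close>
  have payoff: "?u i w = ?V i (w i)" if "\<And>l. l \<in> {1..k} \<Longrightarrow> w l \<in> ?X l" for w i
  proof -
    have "(\<Sum>l\<in>{1..k}. w l) \<le> (\<Sum>l\<in>{1..k}. ?d l)"
      using that by (intro sum_mono) (auto simp: strategies_def)
    with le show ?thesis by (simp add: payoff_def)
  qed
  have d_in: "?d i \<in> ?X i" for i
    using optimal_demand_is_least_maximizer(1)[OF ps] by (simp add: strategies_def)
  show ?thesis
  proof
    assume ne: "nash_equilibrium {1..k} ?X ?u z"
    then have z: "z \<in> (\<Pi>\<^sub>E i\<in>{1..k}. ?X i)" by (simp add: nash_equilibrium_def)
    have "z i = ?d i" if i: "i \<in> {1..k}" for i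
    proof (rule ccontr)
      assume "z i \<noteq> ?d i"
      moreover have "z i \<in> ?X i" using z i by (rule PiE_mem)
      ultimately have "?V i (z i) < ?V i (?d i)"
        by (intro optimal_demand_is_least_maximizer(3)[OF ps]) (auto simp: strategies_def)
      moreover have "?u i (z(i := ?d i)) \<le> ?u i z"
        using ne i d_in by (simp add: nash_equilibrium_def)
      moreover have "?u i z = ?V i (z i)"
        using PiE_mem[OF z] by (rule payoff)
      moreover have "?u i (z(i := ?d i)) = ?V i (?d i)"
        using payoff[of "z(i := ?d i)" i] PiE_mem[OF z] d_in by simp
      ultimately show False by simp
    qed
    then show "z = (\<lambda>i\<in>{1..k}. ?d i)"
      using z by (intro extensionalityI[of _ "{1..k}"]) (auto simp: PiE_def)
  next
    assume z: "z = (\<lambda>i\<in>{1..k}. ?d i)"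
    have "?u i (z(i := y)) \<le> ?u i z" if i: "i \<in> {1..k}" and y: "y \<in> ?X i" for i y
    proof -
      have "?u i (z(i := y)) = ?V i y"
        using payoff[of "z(i := y)" i] y d_in by (simp add: z)
      also have "\<dots> \<le> ?V i (?d i)"
        using y by (intro optimal_demand_is_least_maximizer(2)[OF ps]) (simp add: strategies_def)
      also have "\<dots> = ?u i z"
        using payoff[of z i] d_in i by (simp add: z)
      finally show ?thesis .
    qed
    then show "nash_equilibrium {1..k} ?X ?u z"
      using d_in by (auto simp: nash_equilibrium_def z)
  qed
qed

text \<open>Asking for more overdraws the pool and yields 0, which is no better than the current
  nonnegative value. Asking for less stays below the demand, where the value is increasing.\<close>

lemma nash_equilibrium_if_sum_eq:
  assumes ps: "production_situation A B p r c"
    and z: "z \<in> (\<Pi>\<^sub>E i\<in>{1..k}. strategies A B p c S i)"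
    and sum: "(\<Sum>i\<in>{1..k}. z i) = r"
  shows "nash_equilibrium {1..k} (strategies A B p c S) (payoff A B p r c k S) z"
proof -
  let ?V = "\<lambda>i. coalition_value A B p c (S i)"
  have mono: "?V i y \<le> ?V i w"
    if "0 \<le> y" "y \<le> w" "w \<in> strategies A B p c S i" for i y w
    using that strict_mono_onD[OF strict_mono_on_coalition_value[OF ps], of y "S i" w]
    by (cases "y = w") (auto simp: strategies_def)
  have "payoff A B p r c k S i (z(i := y)) \<le> payoff A B p r c k S i z"
    if i: "i \<in> {1..k}" and y: "y \<in> strategies A B p c S i" for i y
  proof -
    have zi: "z i \<in> strategies A B p c S i" using z i by (rule PiE_mem)
    have "(\<Sum>l\<in>{1..k}. (z(i := y)) l) = y + (\<Sum>l\<in>{1..k} - {i}. z l)"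
      using i by (simp add: sum.remove)
    also have "\<dots> = y - z i + r"
      using i sum by (simp add: sum.remove[of _ i])
    \<comment> \<open>As the total was \<open>r\<close>, the deviation overdraws the pool exactly
      when \<open>z i < y\<close>.\<close>
    finally have dev: "(\<Sum>l\<in>{1..k}. (z(i := y)) l) = y - z i + r" .
    have "payoff A B p r c k S i z = ?V i (z i)"
      unfolding payoff_def sum by simp
    moreover have "payoff A B p r c k S i (z(i := y)) = (if z i < y then 0 else ?V i y)"
      unfolding payoff_def dev by simp
    moreover have "0 \<le> ?V i (z i)"
      using mono[of 0 "z i" i] zi coalition_value_zero[OF ps] by (simp add: strategies_def)
    moreover have "?V i y \<le> ?V i (z i)" if "\<not> z i < y"
      using mono[of y "z i" i] zi y that by (simp add: strategies_def)
    ultimately show ?thesis by simp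
  qed
  then show ?thesis
    using z by (simp add: nash_equilibrium_def)
qed

theorem theorem4:
  fixes A :: "real^'g^('q::finite option)" and B :: "real^'n^'q" and p :: "real^'g"
    and r c :: real and k :: nat and S :: "nat \<Rightarrow> 'n set" and P :: "'n set set"
  assumes "production_situation A B p r c"
    and "\<And>T. T \<noteq> {} \<Longrightarrow> \<exists>z\<ge>0. coalition_value A B p c T z > 0"
    and "partition_on UNIV P" and "bij_betw S {1..k} P"
  shows "(\<forall>z. nash_equilibrium {1..k} (strategies A B p c S) (payoff A B p r c k S) z \<longleftrightarrow>
              z = (\<lambda>i\<in>{1..k}. optimal_demand A B p c (S i)))
         \<longleftrightarrow> partition_demand A B p c P \<le> r"
proof -
  let ?d = "\<lambda>i. optimal_demand A B p c (S i)"
  have D: "partition_demand A B p c P = (\<Sum>i\<in>{1..k}. ?d i)"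
    unfolding partition_demand_def using sum.reindex_bij_betw[OF assms(4)] by metis
  show ?thesis
  proof
    assume "partition_demand A B p c P \<le> r"
    then show "\<forall>z. nash_equilibrium {1..k} (strategies A B p c S) (payoff A B p r c k S) z \<longleftrightarrow>
        z = (\<lambda>i\<in>{1..k}. ?d i)"
      using nash_equilibrium_iff_if_demand_le[OF assms(1)] D by simp
  next
    assume unique: "\<forall>z. nash_equilibrium {1..k} (strategies A B p c S) (payoff A B p r c k S) z \<longleftrightarrow>
        z = (\<lambda>i\<in>{1..k}. ?d i)"
    show "partition_demand A B p c P \<le> r"
    proof (rule ccontr)
      assume "\<not> partition_demand A B p c P \<le> r"
      then have gt: "r < (\<Sum>i\<in>{1..k}. ?d i)" by (simp add: D)
      have r: "0 < r" using production_situationD(5)[OF assms(1)] .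
      \<comment> \<open>The factor that brings the total down to \<open>r\<close>. It is below 1, so
        the scaled demands remain in the strategy sets.\<close>
      define s where "s = r / (\<Sum>i\<in>{1..k}. ?d i)"
      have s: "0 < s" "s < 1" using gt r by (auto simp: s_def)
      define z where "z = (\<lambda>i\<in>{1..k}. s * ?d i)"
      have "z \<in> (\<Pi>\<^sub>E i\<in>{1..k}. strategies A B p c S i)"
        using s optimal_demand_is_least_maximizer(1)[OF assms(1)]
        by (auto simp: z_def strategies_def mult_left_le_one_le)
      moreover have sum_z: "(\<Sum>i\<in>{1..k}. z i) = r"
      proof -
        have "(\<Sum>i\<in>{1..k}. z i) = s * (\<Sum>i\<in>{1..k}. ?d i)"
          by (simp add: z_def sum_distrib_left)
        then show ?thesis using gt r by (simp add: s_def)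
      qed
      ultimately have "z = (\<lambda>i\<in>{1..k}. ?d i)"
        using unique nash_equilibrium_if_sum_eq[OF assms(1)] by blast
      \<comment> \<open>Equal profiles would have equal totals, but one total is \<open>r\<close>
        and the other exceeds it.\<close>
      with sum_z gt show False by simp
    qed
  qed
qed

end
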